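(* Let $D_i, M_i, T_{ij}$ be positive real constants and consider the second-order linear system $$\begin{bmatrix}\dot x^{(i)}_1\\ \dot x^{(i)}_2\end{bmatrix}=\begin{bmatrix}-\frac{D_i}{M_i} & \frac{1}{M_i}\\ -T_{ij} & 0\end{bmatrix}\begin{bmatrix}x^{(i)}_1\\ x^{(i)}_2\end{bmatrix}+\begin{bmatrix}0\\ T_{ij}\end{bmatrix}x^{(j)}_1,$$ where $x^{(j)}_1$ is an exogenous input. Then the system is asymptotically stable. Furthermore, if $D_i>2\sqrt{T_{ij}M_i}$, then the origin is an asymptotically stable node; if $D_i<2\sqrt{T_{ij}M_i}$, then the origin is an asymptotically stable spiral.
   Context: The system models a single micro-grid $i$: $x^{(i)}_1=f_i$ is its frequency deviation, $x^{(i)}_2=P_i$ the power flow into it, $x^{(j)}_1=f_j$ the (exogenous) frequency of the mains, $M_i$ the inertia constant, $D_i$ the damping constant, and $T_{ij}$ the synchronizing coefficient (the inverse of a transmission reactance). Stability and the classification of the origin refer to the autonomous system with zero input, $\dot x=Ax$, where $A$ is the $2\times 2$ state matrix above. The origin is an asymptotically stable node if both eigenvalues of $A$ are real, distinct and negative, and an asymptotically stable spiral if the eigenvalues of $A$ are non-real complex conjugates with negative real part. *)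

theory Defs
  imports "HOL-Analysis.Analysis"
begin

text \<open>
  Linear system with state matrix \<open>A\<close>, input vector \<open>B\<close> and scalar input \<open>u\<close>; the derivative
  at time 0 is one-sided.
\<close>

definition lti_solution ::
  "real^'n^'n \<Rightarrow> real^'n \<Rightarrow> (real \<Rightarrow> real) \<Rightarrow> (real \<Rightarrow> real^'n) \<Rightarrow> bool" where
  "lti_solution A B u x \<longleftrightarrow>
    (\<forall>t\<ge>0. (x has_vector_derivative (A *v x t + u t *\<^sub>R B)) (at t within {0..}))"

text \<open>
  Asymptotic stability of a linear system, in the sense of Lyapunov, for the autonomous system
  obtained with zero input. The attraction clause is global; for a linear system this is the same
  as local attraction. Quantifying over solutions on all of \<open>[0,\<infinity>)\<close> loses nothing, because every
  initial state of a linear system has such a solution.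
\<close>

definition lti_asymptotically_stable :: "real^'n^'n \<Rightarrow> real^'n \<Rightarrow> bool" where
  "lti_asymptotically_stable A B \<longleftrightarrow>
    (\<forall>\<epsilon>>0. \<exists>\<delta>>0. \<forall>x. lti_solution A B (\<lambda>_. 0) x \<longrightarrow> norm (x 0) < \<delta> \<longrightarrow>
        (\<forall>t\<ge>0. norm (x t) < \<epsilon>)) \<and>
    (\<forall>x. lti_solution A B (\<lambda>_. 0) x \<longrightarrow> (x \<longlongrightarrow> 0) at_top)"

text \<open>The eigenvalues of a real matrix, real or not: those of its complexification.\<close>

definition eigenvalues :: "real^'n^'n \<Rightarrow> complex set" where
  "eigenvalues A = {\<mu>. \<exists>v::complex^'n. v \<noteq> 0 \<and> map_matrix complex_of_real A *v v = \<mu> *s v}"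

definition asymptotically_stable_node :: "real^2^2 \<Rightarrow> bool" where
  "asymptotically_stable_node A \<longleftrightarrow>
    (\<exists>a b::real. a \<noteq> b \<and> a < 0 \<and> b < 0 \<and>
      eigenvalues A = {complex_of_real a, complex_of_real b})"

definition asymptotically_stable_spiral :: "real^2^2 \<Rightarrow> bool" where
  "asymptotically_stable_spiral A \<longleftrightarrow>
    (\<exists>\<mu>. Im \<mu> \<noteq> 0 \<and> Re \<mu> < 0 \<and> eigenvalues A = {\<mu>, cnj \<mu>})"

text \<open>
  Micro-grid with damping constant \<open>D\<close>, inertia constant \<open>M\<close> and synchronizing coefficient \<open>T\<close>.
  The state consists of the frequency deviation and the power flow into the micro-grid, the input
  is the frequency of the mains.
\<close>

definition microgrid_matrix :: "real \<Rightarrow> real \<Rightarrow> real \<Rightarrow> real^2^2" where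
  "microgrid_matrix D M T = vector [vector [- (D / M), 1 / M], vector [- T, 0]]"

definition microgrid_input :: "real \<Rightarrow> real^2" where
  "microgrid_input T = vector [0, T]"

end

theory Submission
  imports Defs "HOL-Real_Asymp.Real_Asymp"
begin

text \<open>
  The eigenvalues of a \<open>2 \<times> 2\<close> matrix are the roots of \<open>\<mu>\<^sup>2 - trace A * \<mu> + det A\<close>, so the type of
  the origin is decided by the sign of the discriminant, here that of \<open>D\<^sup>2 - 4 * T * M\<close>.

  For stability, the energy \<open>E = T * M * f\<^sup>2 + P\<^sup>2\<close> has derivative \<open>- 2 * T * D * f\<^sup>2\<close>, which is only
  semidefinite. Adding a cross term gives the strict Lyapunov function \<open>V = E - 2 * c * f * P\<close> with
  \<open>c = 2 * T * M * D / (D\<^sup>2 + 4 * T * M)\<close>; it satisfies \<open>E / 2 \<le> V \<le> 3 * E / 2\<close> and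
  \<open>V' \<le> - (c / M) * E\<close>, whence exponential decay.
\<close>

section \<open>Eigenvalues and the type of the origin\<close>

lemma eigenvalues_eq_det:
  fixes A :: "real^'n^'n"
  shows "eigenvalues A = {\<mu>. det (map_matrix complex_of_real A - mat \<mu>) = 0}"
proof -
  have "(\<exists>v::complex^'n. v \<noteq> 0 \<and> map_matrix complex_of_real A *v v = \<mu> *s v) \<longleftrightarrow>
        det (map_matrix complex_of_real A - mat \<mu>) = 0" for \<mu>
  proof -
    let ?B = "map_matrix complex_of_real A - mat \<mu>"
    have mat: "mat \<mu> *v v = \<mu> *s v" for v :: "complex^'n"
      by (simp add: matrix_vector_mult_def mat_def vec_eq_iff if_distrib[of "\<lambda>x. x * _"] cong: if_cong)
    have "?B *v v = map_matrix complex_of_real A *v v - \<mu> *s v" for v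
      by (simp add: matrix_vector_mult_diff_rdistrib mat)
    then have "(\<exists>v. v \<noteq> 0 \<and> map_matrix complex_of_real A *v v = \<mu> *s v) \<longleftrightarrow> (\<exists>v. v \<noteq> 0 \<and> ?B *v v = 0)"
      by simp
    also have "\<dots> \<longleftrightarrow> \<not> invertible ?B"
      using matrix_left_invertible_ker[of ?B] by (auto simp: invertible_left_inverse)
    finally show ?thesis
      by (simp add: invertible_det_nz)
  qed
  then show ?thesis
    by (simp add: eigenvalues_def)
qed

text \<open>By Vieta, the sum and product conditions factor the characteristic polynomial as
  \<open>(\<mu> - a) * (\<mu> - b)\<close>. Candidates for the roots, real or not, thus need only
  two identities.\<close>

lemma eigenvalues_2:
  fixes A :: "real^2^2"
  assumes "a + b = complex_of_real (trace A)" and "a * b = complex_of_real (det A)"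
  shows "eigenvalues A = {a, b}"
proof -
  have "det (map_matrix complex_of_real A - mat \<mu>) =
      \<mu>\<^sup>2 - complex_of_real (trace A) * \<mu> + complex_of_real (det A)" for \<mu>
    by (simp add: det_2 trace_def sum_2 mat_def map_matrix_def power2_eq_square algebra_simps)
  also have "\<dots> \<mu> = (\<mu> - a) * (\<mu> - b)" for \<mu>
    by (simp add: assms[symmetric] power2_eq_square algebra_simps)
  finally show ?thesis
    by (auto simp: eigenvalues_eq_det)
qed

lemma asymptotically_stable_nodeI:
  fixes A :: "real^2^2"
  assumes "trace A < 0" and "det A > 0" and "(trace A)\<^sup>2 > 4 * det A"
  shows "asymptotically_stable_node A"
proof -
  define s where "s = sqrt ((trace A)\<^sup>2 - 4 * det A)"
  define a where "a = (trace A + s) / 2"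
  define b where "b = (trace A - s) / 2"
  have s: "s > 0" "s\<^sup>2 = (trace A)\<^sup>2 - 4 * det A"
    using assms by (simp_all add: s_def)
  \<comment> \<open>Positivity of the determinant gives \<open>s^2 < (trace A)^2\<close>; this makes
    the larger root \<open>a\<close> negative.\<close>
  have "s < - trace A"
    using assms s by (intro power2_less_imp_less[of s "- trace A"]) auto
  have sum: "a + b = trace A" and prod: "a * b = det A"
    using s(2) by (simp_all add: a_def b_def field_simps power2_eq_square)
  have "eigenvalues A = {complex_of_real a, complex_of_real b}"
    by (rule eigenvalues_2) (simp_all flip: sum prod)
  moreover have "a \<noteq> b" "a < 0" "b < 0"
    using s(1) \<open>s < - trace A\<close> assms(1) by (simp_all add: a_def b_def)
  ultimately show ?thesis
    unfolding asymptotically_stable_node_def by blast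
qed

text \<open>A negative discriminant gives a conjugate pair of roots whose real part is half the
  trace.\<close>

lemma asymptotically_stable_spiralI:
  fixes A :: "real^2^2"
  assumes "trace A < 0" and "(trace A)\<^sup>2 < 4 * det A"
  shows "asymptotically_stable_spiral A"
proof -
  define s where "s = sqrt (4 * det A - (trace A)\<^sup>2)"
  define \<mu> where "\<mu> = Complex (trace A / 2) (s / 2)"
  have s: "s > 0" "s\<^sup>2 = 4 * det A - (trace A)\<^sup>2"
    using assms by (simp_all add: s_def)
  have "eigenvalues A = {\<mu>, cnj \<mu>}"
    by (rule eigenvalues_2) (use s(2) in \<open>simp_all add: \<mu>_def complex_eq_iff field_simps power2_eq_square\<close>)
  moreover have "Im \<mu> \<noteq> 0" "Re \<mu> < 0"
    using s(1) assms(1) by (simp_all add: \<mu>_def)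
  ultimately show ?thesis
    unfolding asymptotically_stable_spiral_def by blast
qed

section \<open>From a differential inequality to asymptotic stability\<close>

lemma exponential_decay:
  fixes V V' :: "real \<Rightarrow> real"
  assumes deriv: "\<And>t. t \<ge> 0 \<Longrightarrow> (V has_real_derivative V' t) (at t within {0..})"
    and le: "\<And>t. t \<ge> 0 \<Longrightarrow> V' t \<le> - k * V t"
    and "t \<ge> 0"
  shows "V t \<le> V 0 * exp (- k * t)"
proof -
  \<comment> \<open>The integrating factor turns the differential inequality into
    \<open>W' \<le> 0\<close>.\<close>
  define W where "W = (\<lambda>t. V t * exp (k * t))"
  have W: "(W has_real_derivative (V' s + k * V s) * exp (k * s)) (at s within {0..})"
    if "s \<ge> 0" for s
    unfolding W_def using that
    by (auto intro!: derivative_eq_intros deriv simp: algebra_simps)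
  have "W t \<le> W 0"
  \<comment> \<open>The derivative at 0 is only one-sided, so derivatives are used in the open
    interval and mere continuity at its ends.\<close>
  proof (rule DERIV_nonpos_imp_decreasing_open[OF \<open>t \<ge> 0\<close>])
    fix s
    assume "0 < s" "s < t"
    then have "at s within {0..} = at s"
      by (intro at_within_interior) simp
    then have "(W has_real_derivative (V' s + k * V s) * exp (k * s)) (at s)"
      using W[of s] \<open>0 < s\<close> by simp
    moreover have "(V' s + k * V s) * exp (k * s) \<le> 0"
      using le[of s] \<open>0 < s\<close> by (intro mult_nonpos_nonneg) auto
    ultimately show "\<exists>y. (W has_real_derivative y) (at s) \<and> y \<le> 0"
      by blast
  next
    have "continuous_on {0..} W"
      using W by (intro DERIV_continuous_on) auto
    then show "continuous_on {0..t} W"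
      by (rule continuous_on_subset) auto
  qed
  then have "V t * exp (k * t) \<le> V 0"
    by (simp add: W_def)
  then show ?thesis
    by (simp add: exp_minus field_simps)
qed

text \<open>One estimate yields both clauses: dropping the exponential gives stability, letting
  \<open>t\<close> tend to infinity gives attraction. The norms are squared because a quadratic
  Lyapunov function controls squares.\<close>

lemma lti_asymptotically_stableI:
  assumes "K > 0" and "k > 0"
    and bound: "\<And>x t. lti_solution A B (\<lambda>_. 0) x \<Longrightarrow> t \<ge> 0 \<Longrightarrow>
      (norm (x t))\<^sup>2 \<le> K * (norm (x 0))\<^sup>2 * exp (- k * t)"
  shows "lti_asymptotically_stable A B"
  unfolding lti_asymptotically_stable_def
proof (intro conjI allI impI)
  fix \<epsilon> :: real
  assume "\<epsilon> > 0"
  show "\<exists>\<delta>>0. \<forall>x. lti_solution A B (\<lambda>_. 0) x \<longrightarrow> norm (x 0) < \<delta> \<longrightarrow> (\<forall>t\<ge>0. norm (x t) < \<epsilon>)"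
  \<comment> \<open>This radius \<open>\<delta>\<close> solves
    \<open>K * \<delta>^2 = \<epsilon>^2\<close>.\<close>
  proof (intro exI[of _ "\<epsilon> / sqrt K"] conjI allI impI)
    show "\<epsilon> / sqrt K > 0"
      using \<open>\<epsilon> > 0\<close> \<open>K > 0\<close> by simp
  next
    fix x :: "real \<Rightarrow> real^'a" and t :: real
    assume x: "lti_solution A B (\<lambda>_. 0) x" and small: "norm (x 0) < \<epsilon> / sqrt K" and "t \<ge> 0"
    have "(norm (x t))\<^sup>2 \<le> K * (norm (x 0))\<^sup>2 * exp (- k * t)"
      by (rule bound[OF x \<open>t \<ge> 0\<close>])
    also have "\<dots> \<le> K * (norm (x 0))\<^sup>2 * 1"
      using \<open>K > 0\<close> \<open>k > 0\<close> \<open>t \<ge> 0\<close> by (intro mult_left_mono) auto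
    also have "\<dots> < K * (\<epsilon> / sqrt K)\<^sup>2 * 1"
      using small \<open>K > 0\<close> by (simp add: power_strict_mono)
    also have "\<dots> = \<epsilon>\<^sup>2"
      using \<open>K > 0\<close> by (simp add: power_divide)
    finally show "norm (x t) < \<epsilon>"
      using \<open>\<epsilon> > 0\<close> by (simp add: power2_less_imp_less)
  qed
next
  fix x :: "real \<Rightarrow> real^'a"
  assume x: "lti_solution A B (\<lambda>_. 0) x"
  have "((\<lambda>t. exp (- k * t)) \<longlongrightarrow> 0) at_top"
    using \<open>k > 0\<close> by real_asymp
  then have lim: "((\<lambda>t. K * (norm (x 0))\<^sup>2 * exp (- k * t)) \<longlongrightarrow> 0) at_top"
    by (rule tendsto_mult_right_zero)
  have "\<forall>\<^sub>F t in at_top. (norm (x t))\<^sup>2 \<le> K * (norm (x 0))\<^sup>2 * exp (- k * t)"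
    using eventually_ge_at_top[of 0] by eventually_elim (rule bound[OF x])
  then have "((\<lambda>t. (norm (x t))\<^sup>2) \<longlongrightarrow> 0) at_top"
    by (intro tendsto_sandwich[OF _ _ tendsto_const lim]) auto
  then have "((\<lambda>t. sqrt ((norm (x t))\<^sup>2)) \<longlongrightarrow> sqrt 0) at_top"
    by (rule tendsto_real_sqrt)
  then show "(x \<longlongrightarrow> 0) at_top"
    by (simp add: tendsto_norm_zero_iff)
qed

text \<open>The first bound makes \<open>V = E - 2 * c * f * P\<close> comparable to
  \<open>E\<close>; the left-hand side of the second is the derivative of \<open>V\<close> along
  zero-input solutions.\<close>

lemma microgrid_lyapunov_bounds:
  fixes D M T f P :: real
  assumes "D > 0" and "M > 0" and "T > 0"
  defines "c \<equiv> 2 * T * M * D / (D\<^sup>2 + 4 * T * M)"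
    and "E \<equiv> T * M * f\<^sup>2 + P\<^sup>2"
  shows "\<bar>2 * c * f * P\<bar> \<le> E / 2"
    and "- 2 * T * (D - c) * f\<^sup>2 + 2 * c * D / M * f * P - 2 * c / M * P\<^sup>2 \<le> - (c / M) * E"
proof -
  define r where "r = sqrt (T * M)"
  have r: "r > 0" "T * M = r\<^sup>2"
    using assms by (simp_all add: r_def)
  have pos: "D\<^sup>2 + 4 * T * M > 0"
    using assms by (simp add: add_pos_pos)
  then have c: "c * (D\<^sup>2 + 4 * T * M) = 2 * T * M * D"
    by (simp add: c_def)
  have "c > 0"
    using assms pos by (simp add: c_def)
  have "2 * c \<le> r"
  proof -
    \<comment> \<open>This is \<open>r * (D - 2 * r)^2 \<ge> 0\<close>, expanded.\<close>
    have "4 * D * r\<^sup>2 \<le> r * (D\<^sup>2 + 4 * r\<^sup>2)"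
      using mult_nonneg_nonneg[OF less_imp_le[OF r(1)] zero_le_power2[of "D - 2 * r"]]
      by (simp add: power2_eq_square algebra_simps)
    moreover have "2 * c * (D\<^sup>2 + 4 * T * M) = 4 * D * (T * M)"
      using c by simp
    ultimately have "2 * c * (D\<^sup>2 + 4 * T * M) \<le> r * (D\<^sup>2 + 4 * T * M)"
      by (simp only: r(2) mult.assoc)
    then show ?thesis
      using pos by simp
  qed
  have "\<bar>2 * c * f * P\<bar> = 2 * c * \<bar>f * P\<bar>"
    using \<open>c > 0\<close> by (simp add: abs_mult)
  also have "\<dots> \<le> r * \<bar>f * P\<bar>"
    using \<open>2 * c \<le> r\<close> by (intro mult_right_mono) auto
  also have "\<dots> = \<bar>r * f\<bar> * \<bar>P\<bar>"
    using r(1) by (simp add: abs_mult)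
  also have "\<dots> \<le> E / 2"
    using zero_le_power2[of "\<bar>r * f\<bar> - \<bar>P\<bar>"]
    by (simp add: E_def r(2) power2_diff power_mult_distrib)
  finally show "\<bar>2 * c * f * P\<bar> \<le> E / 2" .
  define q where "q = c / M"
  have q: "q > 0" "c = q * M"
    using \<open>c > 0\<close> \<open>M > 0\<close> by (simp_all add: q_def)
  \<comment> \<open>The choice of \<open>c\<close> is made for this identity: its
    \<open>q * D^2\<close> is what completes the square \<open>(P - D * f)^2\<close> below, and
    \<open>2 * T * c\<close> covers the \<open>f^2\<close> part of \<open>q * E\<close>, which is
    \<open>T * c * f^2\<close>.\<close>
  have "M * (2 * T * (D - c)) = M * (2 * T * c + q * D\<^sup>2)"
    using c unfolding q(2) by (simp add: algebra_simps)
  then have coeff: "2 * T * (D - c) = 2 * T * c + q * D\<^sup>2"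
    using \<open>M > 0\<close> by simp
  have "- 2 * T * (D - c) * f\<^sup>2 + 2 * q * D * f * P - 2 * q * P\<^sup>2
      = - (2 * T * (D - c)) * f\<^sup>2 + 2 * q * D * f * P - 2 * q * P\<^sup>2"
    by simp
  also have "\<dots> = - q * E - (T * c * f\<^sup>2 + q * (P - D * f)\<^sup>2)"
    unfolding coeff unfolding E_def q(2) by (simp add: power2_eq_square algebra_simps)
  also have "\<dots> \<le> - q * E"
  proof -
    have "T * c * f\<^sup>2 \<ge> 0" "q * (P - D * f)\<^sup>2 \<ge> 0"
      using q(1) \<open>c > 0\<close> \<open>T > 0\<close> by simp_all
    then show ?thesis by linarith
  qed
  finally show "- 2 * T * (D - c) * f\<^sup>2 + 2 * c * D / M * f * P - 2 * c / M * P\<^sup>2 \<le> - (c / M) * E"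
    by (simp add: q_def)
qed

lemma norm_power2_vec2: "(norm (x :: real^2))\<^sup>2 = (x $ 1)\<^sup>2 + (x $ 2)\<^sup>2"
  by (simp add: norm_vec_def L2_set_def sum_2)

lemma microgrid_asymptotically_stable:
  fixes D M T :: real
  assumes "D > 0" and "M > 0" and "T > 0"
  shows "lti_asymptotically_stable (microgrid_matrix D M T) B"
proof -
  define c where "c = 2 * T * M * D / (D\<^sup>2 + 4 * T * M)"
  \<comment> \<open>The rate \<open>c / M\<close> with respect to \<open>E\<close> becomes
    \<open>2 / 3\<close> of it for \<open>V\<close>, since \<open>V \<le> 3 / 2 * E\<close>.\<close>
  define k where "k = 2 * c / (3 * M)"
  \<comment> \<open>The extreme weights of the energy, \<open>l\<close> and \<open>u\<close>,
    compare it with the squared Euclidean norm.\<close>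
  define l where "l = min (T * M) 1"
  define u where "u = max (T * M) 1"
  have "c > 0"
    using assms by (simp add: c_def add_pos_pos)
  then have "k > 0"
    using assms by (simp add: k_def)
  have "l > 0" "u > 0"
    using assms by (simp_all add: l_def u_def)
  show ?thesis
  \<comment> \<open>The factor 3 is the quotient of the bounds \<open>3 / 2\<close> and
    \<open>1 / 2\<close> between \<open>V\<close> and \<open>E\<close>; \<open>u / l\<close> comes
    from passing between \<open>E\<close> and the norm.\<close>
  proof (rule lti_asymptotically_stableI[of "3 * u / l" k])
    fix x :: "real \<Rightarrow> real^2" and t :: real
    assume "lti_solution (microgrid_matrix D M T) B (\<lambda>_. 0) x" and "t \<ge> 0"
    then have x: "(x has_vector_derivative microgrid_matrix D M T *v x t) (at t within {0..})"
      if "t \<ge> 0" for t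
      using that by (simp add: lti_solution_def)
    define E where "E = (\<lambda>t. T * M * (x t $ 1)\<^sup>2 + (x t $ 2)\<^sup>2)"
    define V where "V = (\<lambda>t. E t - 2 * c * x t $ 1 * x t $ 2)"
    define V' where "V' = (\<lambda>t. - 2 * T * (D - c) * (x t $ 1)\<^sup>2
      + 2 * c * D / M * x t $ 1 * x t $ 2 - 2 * c / M * (x t $ 2)\<^sup>2)"
    have comp: "((\<lambda>t. x t $ i) has_real_derivative (microgrid_matrix D M T *v x t) $ i) (at t within {0..})"
      if "t \<ge> 0" for t i
      using bounded_linear.has_vector_derivative[OF bounded_linear_vec_nth x[OF that]]
      by (simp add: has_real_derivative_iff_has_vector_derivative)
    have d1: "((\<lambda>t. x t $ 1) has_real_derivative - (D / M) * x t $ 1 + x t $ 2 / M) (at t within {0..})"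
      and d2: "((\<lambda>t. x t $ 2) has_real_derivative - T * x t $ 1) (at t within {0..})"
      if "t \<ge> 0" for t
      using comp[OF that, of 1] comp[OF that, of 2]
      by (simp_all add: microgrid_matrix_def matrix_vector_mult_def sum_2)
    have dV: "(V has_real_derivative V' t) (at t within {0..})" if "t \<ge> 0" for t
      unfolding V_def E_def V'_def
      by (rule derivative_eq_intros d1[OF that] d2[OF that] refl)+
        (use assms in \<open>simp add: field_simps power2_eq_square\<close>)
    have cross: "\<bar>2 * c * x t $ 1 * x t $ 2\<bar> \<le> E t / 2" for t
      unfolding E_def c_def by (rule microgrid_lyapunov_bounds(1)[OF assms])
    have V: "E t / 2 \<le> V t" "V t \<le> 3 / 2 * E t" for t
      using cross[of t] by (simp_all add: V_def abs_le_iff)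
    have "V' t \<le> - k * V t" for t
    proof -
      have "V' t \<le> - (c / M) * E t"
        unfolding E_def c_def V'_def by (rule microgrid_lyapunov_bounds(2)[OF assms])
      also have "\<dots> = - k * (3 / 2 * E t)"
        by (simp add: k_def)
      also have "\<dots> \<le> - k * V t"
        using V(2)[of t] \<open>k > 0\<close> by simp
      finally show ?thesis .
    qed
    then have decay: "V t \<le> V 0 * exp (- k * t)"
      using dV \<open>t \<ge> 0\<close> by (intro exponential_decay[where V' = V'])
    have E: "l * (norm (x t))\<^sup>2 \<le> E t" "E t \<le> u * (norm (x t))\<^sup>2" for t
      unfolding norm_power2_vec2 distrib_left E_def
      by (intro add_mono; simp add: l_def u_def mult_right_mono mult_le_cancel_right1 mult_le_cancel_right2)+
    have "l * (norm (x t))\<^sup>2 \<le> 2 * V t"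
      using E(1)[of t] V(1)[of t] by simp
    also have "\<dots> \<le> 2 * (V 0 * exp (- k * t))"
      using decay by simp
    also have "\<dots> \<le> 2 * (3 / 2 * (u * (norm (x 0))\<^sup>2) * exp (- k * t))"
      using V(2)[of 0] E(2)[of 0] by (intro mult_left_mono mult_right_mono) auto
    finally show "(norm (x t))\<^sup>2 \<le> 3 * u / l * (norm (x 0))\<^sup>2 * exp (- k * t)"
      using \<open>l > 0\<close> by (simp add: field_simps)
  qed (use \<open>k > 0\<close> \<open>l > 0\<close> \<open>u > 0\<close> in auto)
qed

theorem theorem1:
  fixes D M T :: real
  assumes "D > 0" and "M > 0" and "T > 0"
  shows "lti_asymptotically_stable (microgrid_matrix D M T) (microgrid_input T) \<and>
    (D > 2 * sqrt (T * M) \<longrightarrow> asymptotically_stable_node (microgrid_matrix D M T)) \<and>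
    (D < 2 * sqrt (T * M) \<longrightarrow> asymptotically_stable_spiral (microgrid_matrix D M T))"
proof (intro conjI impI)
  have tr: "trace (microgrid_matrix D M T) = - (D / M)"
    by (simp add: trace_def sum_2 microgrid_matrix_def)
  have det: "det (microgrid_matrix D M T) = T / M"
    by (simp add: det_2 microgrid_matrix_def)
  have sq: "(2 * sqrt (T * M))\<^sup>2 = 4 * T * M"
    using assms by (simp add: power_mult_distrib)
  show "lti_asymptotically_stable (microgrid_matrix D M T) (microgrid_input T)"
    by (rule microgrid_asymptotically_stable[OF assms])
  show "asymptotically_stable_node (microgrid_matrix D M T)" if "D > 2 * sqrt (T * M)"
  proof -
    \<comment> \<open>Both sides of the hypothesis are nonnegative, so it may be squared; division
      by \<open>M^2\<close> then gives the discriminant condition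
      \<open>(D / M)^2 > 4 * (T / M)\<close>.\<close>
    have "4 * T * M < D\<^sup>2"
      using power_strict_mono[OF that, of 2] assms sq by simp
    then show ?thesis
      using assms by (intro asymptotically_stable_nodeI)
        (simp_all add: tr det field_simps power2_eq_square)
  qed
  show "asymptotically_stable_spiral (microgrid_matrix D M T)" if "D < 2 * sqrt (T * M)"
  proof -
    have "D\<^sup>2 < 4 * T * M"
      using power_strict_mono[OF that, of 2] assms sq by simp
    then show ?thesis
      using assms by (intro asymptotically_stable_spiralI)
        (simp_all add: tr det field_simps power2_eq_square)
  qed
qed

end
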